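(* If $\alpha$ is a nested word, then the path-star class $\mathcal R^{\alpha}$ is infinitely defined.
   Context: $\mathbb N=\{1,2,3,\dots\}$. A word is a finite or infinite sequence of letters; letters are natural numbers, and $\alpha_j$ is the $j$-th letter of $\alpha$. For a word $\alpha$ over an alphabet $\mathcal A$ and $\mathcal S\subseteq\mathcal A$, $\alpha^{\mathcal S}$ denotes the word obtained from $\alpha$ by deleting all letters not in $\mathcal S$ (keeping the order of the remaining letters). Branched words: a word $\alpha$ over an alphabet $\mathcal A\subseteq\mathbb N$ is branched, with base set $\mathcal B$ and branch sets $\mathcal H_1,\mathcal H_2,\dots$, if $\mathcal A$ is partitioned into a finite base set $\mathcal B$ and (finitely or infinitely many) branch sets $\mathcal H_1,\mathcal H_2,\dots$, each finite or infinite and ordered by the order inherited from $\mathbb N$, such that in $\alpha$: a base letter can appear immediately after any other letter; the first (smallest) letter of a branch set can appear only immediately after a base letter (or as the first letter of the word); any other letter of a branch set $\mathcal H_i$ can appear only immediately after the letter preceding it in the order of $\mathcal H_i$. Nested words: let $\alpha$ be an infinite branched word over an infinite alphabet $\mathcal A\subseteq\mathbb N$ with base set $\mathcal B_\alpha$ and branch sets $\mathcal H^{\alpha}_1,\mathcal H^{\alpha}_2,\dots$, in which each letter of $\mathcal A$ appears infinitely many times. For a positive integer $\mathfrak b$, $\alpha$ is $\mathfrak b$-nested if every subset $\mathcal S\subseteq\mathcal A$ can be partitioned into a base set $\mathcal B_{\mathcal S}$ and ordered (possibly empty) branch sets $\mathcal H^{\mathcal S}_1,\mathcal H^{\mathcal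 S}_2,\dots$ such that $|\mathcal B_{\mathcal S}|\le\mathfrak b$, $\alpha^{\mathcal S}$ is a branched word with base set $\mathcal B_{\mathcal S}$ and these branch sets, and $\mathcal H^{\mathcal S}_i\subseteq\mathcal H^{\alpha}_i$ with the same ordering for each $i$. A word is nested if it is $\mathfrak b$-nested for some positive integer $\mathfrak b$. Path-star classes: the infinite graph $R^{\alpha}=(V_P\cup V_S,\;E_P\cup E_S)$ has path-vertices $V_P=\{p_j: j\in\mathbb N\}$, star-vertices $V_S=\{s_i: i\in\mathbb N\}$, path edges $E_P=\{p_jp_{j+1}: j\in\mathbb N\}$ and star edges $E_S=\{p_js_{\alpha_j}: j\in\mathbb N\}$. $\mathcal R^{\alpha}$ is the class of all finite induced subgraphs of $R^{\alpha}$ (up to isomorphism). A hereditary class $\mathcal C$ (closed under induced subgraphs) is infinitely defined if its set of minimal forbidden induced subgraphs (graphs not in $\mathcal C$ all of whose proper induced subgraphs are in $\mathcal C$, up to isomorphism) is infinite. *)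

theory Defs
  imports Main "HOL-Library.Infinite_Set" "HOL-Library.Disjoint_Sets"
begin

section \<open>Words\<close>

text \<open>Positions are counted from 0, so \<open>letter w j\<close> is the letter usually written with index
  \<open>j + 1\<close>. Letters are positive integers, see \<open>word_over\<close>.\<close>

datatype word = Fin_Word "nat list" | Inf_Word "nat \<Rightarrow> nat"

primrec positions :: "word \<Rightarrow> nat set" where
  "positions (Fin_Word xs) = {..<length xs}"
| "positions (Inf_Word f) = UNIV"

primrec letter :: "word \<Rightarrow> nat \<Rightarrow> nat" where
  "letter (Fin_Word xs) j = xs ! j"
| "letter (Inf_Word f) j = f j"

definition word_over :: "nat set \<Rightarrow> word \<Rightarrow> bool" where
  "word_over A w \<longleftrightarrow> A \<subseteq> {1..} \<and> letter w ` positions w \<subseteq> A"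

text \<open>Deletion of all letters outside \<open>S\<close>; the surviving positions of an infinite word are listed
  in increasing order, and the result is a finite word if there are only finitely many of them.\<close>

primrec restrict_word :: "word \<Rightarrow> nat set \<Rightarrow> word" where
  "restrict_word (Fin_Word xs) S = Fin_Word (filter (\<lambda>x. x \<in> S) xs)"
| "restrict_word (Inf_Word f) S =
    (if finite {j. f j \<in> S}
     then Fin_Word (map f (sorted_list_of_set {j. f j \<in> S}))
     else Inf_Word (\<lambda>k. f (enumerate {j. f j \<in> S} k)))"

section \<open>Branched and nested words\<close>

text \<open>The branch sets are an indexed family in which empty members are allowed; finitely many branch
  sets are represented by a family that is empty from some index on. A base letter carries no
  restriction; in particular it may follow itself.\<close>

definition branch_partition :: "nat set \<Rightarrow> nat set \<Rightarrow> (nat \<Rightarrow> nat set) \<Rightarrow> bool" where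
  "branch_partition A B H \<longleftrightarrow>
    finite B \<and> A = B \<union> (\<Union>i. H i) \<and> (\<forall>i. B \<inter> H i = {}) \<and> disjoint_family H"

definition branched :: "word \<Rightarrow> nat set \<Rightarrow> nat set \<Rightarrow> (nat \<Rightarrow> nat set) \<Rightarrow> bool" where
  "branched w A B H \<longleftrightarrow>
    word_over A w \<and> branch_partition A B H \<and>
    (\<forall>j \<in> positions w. \<forall>i. letter w j \<in> H i \<longrightarrow>
      (if letter w j = (LEAST x. x \<in> H i)
       then j = 0 \<or> letter w (j - 1) \<in> B
       else j > 0 \<and> letter w (j - 1) = Max {x \<in> H i. x < letter w j}))"

definition b_nested ::
  "nat \<Rightarrow> (nat \<Rightarrow> nat) \<Rightarrow> nat set \<Rightarrow> nat set \<Rightarrow> (nat \<Rightarrow> nat set) \<Rightarrow> bool" where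
  "b_nested b \<alpha> A B H \<longleftrightarrow>
    infinite A \<and> branched (Inf_Word \<alpha>) A B H \<and> (\<forall>a\<in>A. infinite {j. \<alpha> j = a}) \<and>
    (\<forall>S \<subseteq> A. \<exists>B' H'. card B' \<le> b \<and>
       branched (restrict_word (Inf_Word \<alpha>) S) S B' H' \<and> (\<forall>i. H' i \<subseteq> H i))"

definition nested :: "(nat \<Rightarrow> nat) \<Rightarrow> bool" where
  "nested \<alpha> \<longleftrightarrow> (\<exists>b A B H. b \<ge> 1 \<and> b_nested b \<alpha> A B H)"

section \<open>Graphs\<close>

type_synonym 'v graph = "'v set \<times> 'v set set"

abbreviation verts :: "'v graph \<Rightarrow> 'v set" where "verts \<equiv> fst"
abbreviation edges :: "'v graph \<Rightarrow> 'v set set" where "edges \<equiv> snd"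

definition simple_graph :: "'v graph \<Rightarrow> bool" where
  "simple_graph G \<longleftrightarrow> (\<forall>e \<in> edges G. e \<subseteq> verts G \<and> card e = 2)"

definition finite_graph :: "'v graph \<Rightarrow> bool" where
  "finite_graph G \<longleftrightarrow> simple_graph G \<and> finite (verts G)"

definition induced :: "'v graph \<Rightarrow> 'v set \<Rightarrow> 'v graph" where
  "induced G W = (W, {e \<in> edges G. e \<subseteq> W})"

definition isomorphic :: "'v graph \<Rightarrow> 'w graph \<Rightarrow> bool" where
  "isomorphic G H \<longleftrightarrow> (\<exists>f. bij_betw f (verts G) (verts H) \<and>
     (\<forall>u \<in> verts G. \<forall>v \<in> verts G. {u, v} \<in> edges G \<longleftrightarrow> {f u, f v} \<in> edges H))"

text \<open>Every finite graph is isomorphic to one with vertices in \<^typ>\<open>nat\<close>, so a class of finite graphs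
  is represented by an isomorphism-closed set of graphs over \<^typ>\<open>nat\<close>.\<close>

definition hereditary :: "nat graph set \<Rightarrow> bool" where
  "hereditary C \<longleftrightarrow>
    (\<forall>G \<in> C. finite_graph G) \<and>
    (\<forall>G \<in> C. \<forall>H. finite_graph H \<and> isomorphic G H \<longrightarrow> H \<in> C) \<and>
    (\<forall>G \<in> C. \<forall>W \<subseteq> verts G. induced G W \<in> C)"

definition minimal_forbidden :: "nat graph set \<Rightarrow> nat graph set" where
  "minimal_forbidden C =
    {G. finite_graph G \<and> G \<notin> C \<and> (\<forall>W. W \<subset> verts G \<longrightarrow> induced G W \<in> C)}"

definition iso_classes :: "nat graph set \<Rightarrow> nat graph set set" where
  "iso_classes M = M // {(G, H). G \<in> M \<and> H \<in> M \<and> isomorphic G H}"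

definition infinitely_defined :: "nat graph set \<Rightarrow> bool" where
  "infinitely_defined C \<longleftrightarrow> hereditary C \<and> infinite (iso_classes (minimal_forbidden C))"

section \<open>Path-star classes\<close>

text \<open>As for words, path vertices are numbered from 0, whereas star vertices are numbered by the
  letters, that is, from 1.\<close>

datatype ps_vertex = Path nat | Star nat

definition path_star_graph :: "(nat \<Rightarrow> nat) \<Rightarrow> ps_vertex graph" where
  "path_star_graph \<alpha> =
    (range Path \<union> Star ` {1..},
     range (\<lambda>j. {Path j, Path (Suc j)}) \<union> range (\<lambda>j. {Path j, Star (\<alpha> j)}))"

definition path_star_class :: "(nat \<Rightarrow> nat) \<Rightarrow> nat graph set" where
  "path_star_class \<alpha> =
    {G. finite_graph G \<and>
        (\<exists>W \<subseteq> verts (path_star_graph \<alpha>). finite W \<and> isomorphic G (induced (path_star_graph \<alpha>) W))}"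

end

theory Submission
  imports Defs "HOL-Library.Countable"
begin

text \<open>
A hereditary class with only finitely many minimal forbidden graphs is recognised locally: there is
an \<open>N\<close> such that a finite graph belongs to it as soon as all its induced subgraphs on at most \<open>N\<close>
vertices do. The proof shows that the path-star class of a nested word is not recognised locally
(\<open>infinitely_definedI\<close>), and the witnesses are forests. For parameters \<open>m\<close> and \<open>L\<close>, take \<open>m\<close> disjoint
copies of the following tree: a root with four arms, each of which is a path that ends, at distance
\<open>L + 1\<close> from the root, in a vertex with three further leaves. Every vertex has degree 1, 2 or 4, and
the vertices of degree 4, the hubs, are far apart.

The forest is not in the class of a \<open>b\<close>-nested word \<open>\<alpha>\<close> when \<open>m > b\<close> (\<open>nested_excludes_forest\<close>).
Path-vertices of the path-star graph have degree at most 3, so in an embedding all hubs are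
star-vertices. Since no vertex of the forest has degree 3, a path-vertex inside a path segment of the
embedded forest is never attached to an embedded star. Let \<open>S\<close> be the set of letters whose
stars are used. Then two stars joined by a segment carry letters that are consecutive in the
restriction of \<open>\<alpha>\<close> to \<open>S\<close>. That restriction is a branched word with at most \<open>b\<close> base letters, so some
tree avoids the stars of all base letters. In this tree, a letter that follows another one in the
restriction has that other letter as its immediate predecessor in a branch set
(\<open>branch_pred_if_consecutive\<close>). Hence the first star on each arm, seen from the root, is the
predecessor or the successor of the root's letter. These are two candidates for four distinct stars.

Every part of the forest with fewer than \<open>L\<close> vertices is in the class, for any word in which each
letter of an infinite alphabet occurs infinitely often (\<open>small_part_of_forest_embeds\<close>). Such a part
misses a vertex on every arm, so it lies in a disjoint union of spiders, trees that consist of a hub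
and four legs. Spiders are found around star-vertices \<open>s\<^sub>a\<close>: a leg is a window of the path that begins at
an occurrence of \<open>a\<close>. What is needed is a finite set of letters, as large as one likes, such that each
of them has infinitely many occurrences after which none of the chosen letters appears for a long time
(\<open>ex_spiders\<close>).
\<close>

section \<open>Isomorphism and induced subgraphs\<close>

lemma induced_simps [simp]:
  "verts (induced G W) = W"
  "{u, v} \<in> edges (induced G W) \<longleftrightarrow> {u, v} \<in> edges G \<and> u \<in> W \<and> v \<in> W"
  by (auto simp: induced_def)

lemma induced_induced:
  "U \<subseteq> W \<Longrightarrow> induced (induced G W) U = induced G U"
  by (auto simp: induced_def)

lemma isomorphic_refl: "isomorphic G G"
  unfolding isomorphic_def by (rule exI[of _ id]) auto

lemma isomorphic_sym:
  assumes "isomorphic G H" shows "isomorphic H G"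
proof -
  from assms obtain f where f: "bij_betw f (verts G) (verts H)"
    and e: "\<forall>u\<in>verts G. \<forall>v\<in>verts G. {u, v} \<in> edges G \<longleftrightarrow> {f u, f v} \<in> edges H"
    unfolding isomorphic_def by blast
  let ?g = "inv_into (verts G) f"
  have g: "bij_betw ?g (verts H) (verts G)"
    using f by (rule bij_betw_inv_into)
  have "{x, y} \<in> edges H \<longleftrightarrow> {?g x, ?g y} \<in> edges G" if "x \<in> verts H" "y \<in> verts H" for x y
    using e bij_betwE[OF g] bij_betw_inv_into_right[OF f] that by metis
  with g show ?thesis unfolding isomorphic_def by blast
qed

lemma isomorphic_trans:
  assumes "isomorphic G H" "isomorphic H K" shows "isomorphic G K"
proof -
  from assms(1) obtain f where f: "bij_betw f (verts G) (verts H)"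
    and e: "\<forall>u\<in>verts G. \<forall>v\<in>verts G. {u, v} \<in> edges G \<longleftrightarrow> {f u, f v} \<in> edges H"
    unfolding isomorphic_def by blast
  from assms(2) obtain g where g: "bij_betw g (verts H) (verts K)"
    and e': "\<forall>u\<in>verts H. \<forall>v\<in>verts H. {u, v} \<in> edges H \<longleftrightarrow> {g u, g v} \<in> edges K"
    unfolding isomorphic_def by blast
  have "bij_betw (g \<circ> f) (verts G) (verts K)"
    using f g by (rule bij_betw_trans)
  moreover have "\<forall>u\<in>verts G. \<forall>v\<in>verts G.
      {u, v} \<in> edges G \<longleftrightarrow> {(g \<circ> f) u, (g \<circ> f) v} \<in> edges K"
    using e e' bij_betwE[OF f] by simp
  ultimately show ?thesis unfolding isomorphic_def by blast
qed

lemma isomorphic_induced: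
  assumes "isomorphic G H" "U \<subseteq> verts G"
  obtains W where "W \<subseteq> verts H" "isomorphic (induced G U) (induced H W)"
proof -
  from assms(1) obtain f where f: "bij_betw f (verts G) (verts H)"
    and e: "\<forall>u\<in>verts G. \<forall>v\<in>verts G. {u, v} \<in> edges G \<longleftrightarrow> {f u, f v} \<in> edges H"
    unfolding isomorphic_def by blast
  have inj: "inj_on f U"
    using f assms(2) by (auto simp: bij_betw_def intro: inj_on_subset)
  show ?thesis
  proof
    show "f ` U \<subseteq> verts H" using f assms(2) by (auto simp: bij_betw_def)
    show "isomorphic (induced G U) (induced H (f ` U))"
      unfolding isomorphic_def
      by (rule exI[of _ f]) (use e assms(2) inj in \<open>auto simp: bij_betw_def\<close>)
  qed
qed

lemma isomorphic_card: "isomorphic G H \<Longrightarrow> card (verts G) = card (verts H)"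
  unfolding isomorphic_def by (auto dest: bij_betw_same_card)

lemma isomorphic_finite: "isomorphic G H \<Longrightarrow> finite (verts G) \<longleftrightarrow> finite (verts H)"
  unfolding isomorphic_def by (auto dest: bij_betw_finite)

lemma finite_graph_induced:
  "finite_graph G \<Longrightarrow> W \<subseteq> verts G \<Longrightarrow> finite_graph (induced G W)"
  by (auto simp: finite_graph_def simple_graph_def induced_def intro: finite_subset)

text \<open>
Classes of graphs live over the natural numbers, whereas the witnesses are easier to describe
over a datatype of vertices.
\<close>

lemma ex_nat_copy:
  assumes "finite_graph (G :: 'v graph)"
  obtains G' :: "nat graph" where "finite_graph G'" "isomorphic G G'"
proof -
  from assms have fin: "finite (verts G)" and sg: "simple_graph G"
    by (auto simp: finite_graph_def)
  from finite_imp_inj_to_nat_seg[OF fin] obtain f :: "'v \<Rightarrow> nat" where f: "inj_on f (verts G)"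
    by blast
  define G' where "G' = (f ` verts G, (\<lambda>e. f ` e) ` edges G)"
  have sub: "e \<subseteq> verts G" "card e = 2" if "e \<in> edges G" for e
    using sg that by (auto simp: simple_graph_def)
  have "finite_graph G'"
    using fin sub f
    by (fastforce simp: G'_def finite_graph_def simple_graph_def card_image inj_on_subset)
  moreover have "isomorphic G G'"
    unfolding isomorphic_def
  proof (intro exI[of _ f] conjI ballI)
    show "bij_betw f (verts G) (verts G')"
      using f by (simp add: G'_def bij_betw_def)
    fix u v assume uv: "u \<in> verts G" "v \<in> verts G"
    show "{u, v} \<in> edges G \<longleftrightarrow> {f u, f v} \<in> edges G'"
    proof
      assume "{u, v} \<in> edges G"
      then have "f ` {u, v} \<in> edges G'" unfolding G'_def snd_conv by (rule imageI)
      then show "{f u, f v} \<in> edges G'" by simp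
    next
      assume "{f u, f v} \<in> edges G'"
      then obtain e where e: "e \<in> edges G" "f ` {u, v} = f ` e" by (auto simp: G'_def)
      with inj_on_image_eq_iff[OF f, of "{u, v}" e] sub[OF e(1)] uv have "{u, v} = e" by simp
      with e show "{u, v} \<in> edges G" by simp
    qed
  qed
  ultimately show ?thesis ..
qed

section \<open>A criterion for being infinitely defined\<close>

lemma path_star_class_iff:
  "G \<in> path_star_class \<alpha> \<longleftrightarrow> finite_graph G \<and>
     (\<exists>W \<subseteq> verts (path_star_graph \<alpha>). isomorphic G (induced (path_star_graph \<alpha>) W))"
proof -
  have "finite W" if "finite_graph G" "isomorphic G (induced (path_star_graph \<alpha>) W)" for W
    using that isomorphic_finite[OF that(2)] by (simp add: finite_graph_def)
  then show ?thesis unfolding path_star_class_def by blast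
qed

lemma hereditary_path_star_class: "hereditary (path_star_class \<alpha>)"
  unfolding hereditary_def
proof (intro conjI ballI allI impI)
  fix G assume G: "G \<in> path_star_class \<alpha>"
  then show "finite_graph G" by (simp add: path_star_class_iff)
  from G obtain W where W: "W \<subseteq> verts (path_star_graph \<alpha>)"
      "isomorphic G (induced (path_star_graph \<alpha>) W)"
    by (auto simp: path_star_class_iff)
  show "H \<in> path_star_class \<alpha>" if "finite_graph H \<and> isomorphic G H" for H
    using that W by (meson path_star_class_iff isomorphic_trans isomorphic_sym)
  fix U assume U: "U \<subseteq> verts G"
  from isomorphic_induced[OF W(2) U] obtain W' where
    "W' \<subseteq> W" "isomorphic (induced G U) (induced (induced (path_star_graph \<alpha>) W) W')"
    by auto
  with W(1) U \<open>finite_graph G\<close> show "induced G U \<in> path_star_class \<alpha>"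
    by (auto simp: path_star_class_iff finite_graph_induced induced_induced)
qed

text \<open>
If \<open>G\<close> is outside the class, a smallest vertex set that induces a graph outside the class induces a
minimal forbidden graph; it has more than \<open>N\<close> vertices if all parts of size at most \<open>N\<close> are inside.
So the sizes of minimal forbidden graphs are unbounded, while finitely many isomorphism classes would
give only finitely many sizes.
\<close>

lemma infinitely_definedI:
  assumes her: "hereditary C"
    and loc: "\<And>N. \<exists>G. finite_graph G \<and> G \<notin> C \<and>
                 (\<forall>U \<subseteq> verts G. card U \<le> N \<longrightarrow> induced G U \<in> C)"
  shows "infinitely_defined C"
  unfolding infinitely_defined_def
proof (intro conjI her notI)
  let ?M = "minimal_forbidden C"
  let ?r = "{(G, H). G \<in> ?M \<and> H \<in> ?M \<and> isomorphic G H}"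
  assume fin: "finite (iso_classes ?M)"
  have big: "\<exists>F \<in> ?M. N < card (verts F)" for N
  proof -
    from loc[of N] obtain G where G: "finite_graph G" "G \<notin> C"
      and small: "\<And>U. U \<subseteq> verts G \<Longrightarrow> card U \<le> N \<Longrightarrow> induced G U \<in> C" by blast
    define P where "P U \<longleftrightarrow> U \<subseteq> verts G \<and> induced G U \<notin> C" for U
    have "induced G (verts G) = G"
      using G by (cases G) (auto simp: induced_def finite_graph_def simple_graph_def)
    with G have "P (verts G)" by (simp add: P_def)
    then obtain U where U: "P U" "\<And>X. P X \<Longrightarrow> card U \<le> card X"
      using ex_has_least_nat[of P "verts G" card] by blast
    have finU: "finite U"
      using U(1) G by (auto simp: P_def finite_graph_def intro: finite_subset)
    have "induced (induced G U) X \<in> C" if "X \<subset> U" for X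
    proof -
      have "card X < card U" using finU that by (rule psubset_card_mono)
      with U(2)[of X] have "\<not> P X" by linarith
      with that U(1) show ?thesis by (auto simp: P_def induced_induced)
    qed
    with U(1) G(1) have "induced G U \<in> ?M"
      by (auto simp: minimal_forbidden_def P_def finite_graph_induced)
    moreover have "N < card U" using small[of U] U(1) by (auto simp: P_def not_le[symmetric])
    ultimately show ?thesis by (metis induced_simps(1))
  qed
  have "finite ((\<lambda>G. card (verts G)) ` X)" if "X \<in> iso_classes ?M" for X
  proof -
    from that obtain G where "X = ?r `` {G}" unfolding iso_classes_def by (rule quotientE)
    then have "(\<lambda>G. card (verts G)) ` X \<subseteq> {card (verts G)}" by (auto dest: isomorphic_card)
    then show ?thesis by (rule finite_subset) simp
  qed
  with fin have "finite (\<Union>X \<in> iso_classes ?M. (\<lambda>G. card (verts G)) ` X)" by blast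
  moreover have "(\<lambda>G. card (verts G)) ` ?M \<subseteq> (\<Union>X \<in> iso_classes ?M. (\<lambda>G. card (verts G)) ` X)"
  proof clarify
    fix G assume "G \<in> ?M"
    then have "G \<in> ?r `` {G}" by (simp add: isomorphic_refl)
    moreover from \<open>G \<in> ?M\<close> have "?r `` {G} \<in> iso_classes ?M"
      unfolding iso_classes_def by (rule quotientI)
    ultimately show "card (verts G) \<in> (\<Union>X \<in> iso_classes ?M. (\<lambda>G. card (verts G)) ` X)" by blast
  qed
  ultimately have "finite ((\<lambda>G. card (verts G)) ` ?M)" by (rule rev_finite_subset)
  then obtain N where "\<forall>n \<in> (\<lambda>G. card (verts G)) ` ?M. n \<le> N"
    by (auto simp: finite_nat_set_iff_bounded_le)
  with big[of N] show False by fastforce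
qed

section \<open>Forests with distant hubs\<close>

fun ps_adj :: "(nat \<Rightarrow> nat) \<Rightarrow> ps_vertex \<Rightarrow> ps_vertex \<Rightarrow> bool" where
  "ps_adj \<alpha> (Path x) (Path y) \<longleftrightarrow> y = Suc x \<or> x = Suc y"
| "ps_adj \<alpha> (Path x) (Star a) \<longleftrightarrow> \<alpha> x = a"
| "ps_adj \<alpha> (Star a) (Path x) \<longleftrightarrow> \<alpha> x = a"
| "ps_adj \<alpha> (Star a) (Star b) \<longleftrightarrow> False"

lemma path_star_edge_iff: "{u, v} \<in> edges (path_star_graph \<alpha>) \<longleftrightarrow> ps_adj \<alpha> u v"
proof -
  have "{u, v} \<in> edges (path_star_graph \<alpha>) \<longleftrightarrow>
      (\<exists>j. {u, v} = {Path j, Path (Suc j)}) \<or> (\<exists>j. {u, v} = {Path j, Star (\<alpha> j)})"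
    unfolding path_star_graph_def snd_conv Un_iff by (simp only: image_iff bex_UNIV)
  also have "\<dots> \<longleftrightarrow> ps_adj \<alpha> u v"
    unfolding doubleton_eq_iff by (cases u; cases v) auto
  finally show ?thesis .
qed

text \<open>
In \<open>Root i\<close>, \<open>Arm i k r\<close> and \<open>Leaf i k l\<close>, the index \<open>i\<close> is the number of the tree, \<open>k < 4\<close> the number of the
arm, \<open>r \<le> L\<close> the position on the arm, counted from the root, and \<open>l < 3\<close> the number of the leaf at the
end of the arm. Edges are generated by the relation \<open>link\<close> from parent to child.
\<close>

datatype tree_vertex = Root nat | Arm nat nat nat | Leaf nat nat nat

fun link :: "nat \<Rightarrow> tree_vertex \<Rightarrow> tree_vertex \<Rightarrow> bool" where
  "link L (Root i) (Arm i' k r) \<longleftrightarrow> i' = i \<and> r = 0"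
| "link L (Arm i k r) (Arm i' k' r') \<longleftrightarrow> i' = i \<and> k' = k \<and> r' = Suc r"
| "link L (Arm i k r) (Leaf i' k' l) \<longleftrightarrow> i' = i \<and> k' = k \<and> r = L"
| "link L _ _ \<longleftrightarrow> False"

definition forest_verts :: "nat \<Rightarrow> nat \<Rightarrow> tree_vertex set" where
  "forest_verts m L = {Root i | i. i < m} \<union> {Arm i k r | i k r. i < m \<and> k < 4 \<and> r \<le> L}
     \<union> {Leaf i k l | i k l. i < m \<and> k < 4 \<and> l < 3}"

definition forest :: "nat \<Rightarrow> nat \<Rightarrow> tree_vertex graph" where
  "forest m L = (forest_verts m L,
     {{u, v} | u v. u \<in> forest_verts m L \<and> v \<in> forest_verts m L \<and> link L u v})"

lemma forest_verts_iff [simp]: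
  "Root i \<in> forest_verts m L \<longleftrightarrow> i < m"
  "Arm i k r \<in> forest_verts m L \<longleftrightarrow> i < m \<and> k < 4 \<and> r \<le> L"
  "Leaf i k l \<in> forest_verts m L \<longleftrightarrow> i < m \<and> k < 4 \<and> l < 3"
  by (auto simp: forest_verts_def)

lemma verts_forest [simp]: "verts (forest m L) = forest_verts m L"
  by (simp add: forest_def)

lemma forest_edge_iff:
  "{u, v} \<in> edges (forest m L) \<longleftrightarrow>
     u \<in> forest_verts m L \<and> v \<in> forest_verts m L \<and> (link L u v \<or> link L v u)"
  by (auto simp: forest_def doubleton_eq_iff)

lemma link_irrefl: "\<not> link L u u"
  by (cases u) auto

lemma finite_graph_forest: "finite_graph (forest m L)"
proof -
  have "forest_verts m L \<subseteq> Root ` {..<m} \<union>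
      (\<lambda>(i, k, r). Arm i k r) ` ({..<m} \<times> {..<4} \<times> {..L}) \<union>
      (\<lambda>(i, k, r). Leaf i k r) ` ({..<m} \<times> {..<4} \<times> {..<3})"
    by (auto simp: forest_verts_def image_iff)
  then have "finite (forest_verts m L)" by (rule finite_subset) simp
  then show ?thesis
    by (auto simp: finite_graph_def simple_graph_def forest_def card_2_iff)
       (metis link_irrefl)
qed

section \<open>Nested words exclude the forests\<close>

text \<open>
This is the relation "immediate predecessor in a common branch set", stated without \<open>Max\<close>, whose
value on the empty set is unspecified.
\<close>

definition branch_pred :: "(nat \<Rightarrow> nat set) \<Rightarrow> nat \<Rightarrow> nat \<Rightarrow> bool" where
  "branch_pred H x y \<longleftrightarrow>
     (\<exists>i. x \<in> H i \<and> y \<in> H i \<and> x < y \<and> (\<forall>z\<in>H i. z < y \<longrightarrow> z \<le> x))"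

lemma branch_pred_unique:
  assumes "disjoint_family H"
  shows "branch_pred H x y \<Longrightarrow> branch_pred H x' y \<Longrightarrow> x = x'"
    and "branch_pred H x y \<Longrightarrow> branch_pred H x y' \<Longrightarrow> y = y'"
proof -
  have same: "i = i'" if "z \<in> H i" "z \<in> H i'" for z i i'
    using assms that by (auto simp: disjoint_family_on_def)
  show "x = x'" if pred: "branch_pred H x y" "branch_pred H x' y"
  proof -
    from pred obtain i i' where
      "x \<in> H i" "y \<in> H i" "x < y" "\<forall>z\<in>H i. z < y \<longrightarrow> z \<le> x"
      "x' \<in> H i'" "y \<in> H i'" "x' < y" "\<forall>z\<in>H i'. z < y \<longrightarrow> z \<le> x'"
      unfolding branch_pred_def by blast
    moreover from this have "i' = i" using same by blast
    ultimately show ?thesis by (meson antisym)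
  qed
  show "y = y'" if pred: "branch_pred H x y" "branch_pred H x y'"
  proof -
    from pred obtain i i' where
      "x \<in> H i" "y \<in> H i" "x < y" "\<forall>z\<in>H i. z < y \<longrightarrow> z \<le> x"
      "x \<in> H i'" "y' \<in> H i'" "x < y'" "\<forall>z\<in>H i'. z < y' \<longrightarrow> z \<le> x"
      unfolding branch_pred_def by blast
    moreover from this have "i' = i" using same by blast
    ultimately show ?thesis by (metis leD linorder_cases)
  qed
qed

text \<open>
The positions \<open>u\<close> and \<open>v\<close> become neighbours when the letters outside \<open>S\<close> are deleted. The letter at
\<open>v\<close> lies in a branch set, and it is not the first one there because a first letter follows a base letter;
so the branching condition puts its predecessor in the branch set directly in front of it.
\<close>

lemma branch_pred_if_consecutive:
  assumes br: "branched (restrict_word (Inf_Word \<alpha>) S) S B H"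
    and inf: "infinite {j. \<alpha> j \<in> S}"
    and uv: "u < v" "\<alpha> u \<in> S - B" "\<alpha> v \<in> S - B"
    and gap: "\<And>w. u < w \<Longrightarrow> w < v \<Longrightarrow> \<alpha> w \<notin> S"
  shows "branch_pred H (\<alpha> u) (\<alpha> v)"
proof -
  let ?P = "{j. \<alpha> j \<in> S}"
  let ?w = "restrict_word (Inf_Word \<alpha>) S"
  obtain n where n: "enumerate ?P n = u" using uv inf by (metis DiffD1 enumerate_Ex mem_Collect_eq)
  have "enumerate ?P (Suc n) = (LEAST s. s \<in> ?P \<and> u < s)"
    using enumerate_Suc''[OF inf, of n] n by simp
  also have "\<dots> = v"
    using uv gap by (intro Least_equality) (auto simp: not_less[symmetric])
  finally have n': "enumerate ?P (Suc n) = v" .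
  have let1: "letter ?w n = \<alpha> u" "letter ?w (Suc n) = \<alpha> v" "Suc n \<in> positions ?w"
    using inf n n' by simp_all
  from br have part: "branch_partition S B H"
    and all: "\<forall>j \<in> positions ?w. \<forall>i. letter ?w j \<in> H i \<longrightarrow>
      (if letter ?w j = (LEAST x. x \<in> H i)
       then j = 0 \<or> letter ?w (j - 1) \<in> B
       else j > 0 \<and> letter ?w (j - 1) = Max {x \<in> H i. x < letter ?w j})"
    unfolding branched_def by blast+
  have rule: "if \<alpha> v = (LEAST x. x \<in> H i) then \<alpha> u \<in> B
         else \<alpha> u = Max {x \<in> H i. x < \<alpha> v}" if "\<alpha> v \<in> H i" for i
    using all[THEN bspec, OF let1(3), THEN spec, of i] that
    unfolding let1(2) diff_Suc_1 let1(1) by (simp only: nat.distinct(2) zero_less_Suc simp_thms)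
  from part uv(3) obtain i where i: "\<alpha> v \<in> H i" by (auto simp: branch_partition_def)
  from rule[OF i] uv(2) have ne: "\<alpha> v \<noteq> (LEAST x. x \<in> H i)"
    and mx: "\<alpha> u = Max {x \<in> H i. x < \<alpha> v}" by (auto split: if_splits)
  have "(LEAST x. x \<in> H i) \<in> H i" "(LEAST x. x \<in> H i) \<le> \<alpha> v"
    using i by (auto intro: LeastI Least_le)
  with ne have "{x \<in> H i. x < \<alpha> v} \<noteq> {}" by fastforce
  then have "\<alpha> u \<in> {x \<in> H i. x < \<alpha> v}" unfolding mx by (intro Max_in) auto
  moreover have "z \<le> \<alpha> u" if "z \<in> H i" "z < \<alpha> v" for z
    unfolding mx using that by (intro Max_ge) auto
  ultimately show ?thesis unfolding branch_pred_def using i by blast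
qed

text \<open>
A path in the path-star graph that uses only path-vertices runs in one direction: to turn round it
would have to revisit a vertex.
\<close>

lemma unit_walk_monotone:
  fixes p :: "nat \<Rightarrow> nat"
  assumes step: "\<And>r. r < n \<Longrightarrow> p (Suc r) = Suc (p r) \<or> p r = Suc (p (Suc r))"
    and inj: "inj_on p {..n}"
  shows "(\<forall>r\<le>n. p r = p 0 + r) \<or> (\<forall>r\<le>n. p 0 = p r + r)"
  using assms
proof (induction n)
  case 0 show ?case by simp
next
  case (Suc n)
  have IH: "(\<forall>r\<le>n. p r = p 0 + r) \<or> (\<forall>r\<le>n. p 0 = p r + r)"
    using Suc.prems by (intro Suc.IH) (auto intro: inj_on_subset)
  have st: "p (Suc n) = Suc (p n) \<or> p n = Suc (p (Suc n))" using Suc.prems(1)[of n] by simp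
  show ?case
  proof (cases n)
    case 0
    with st show ?thesis by (auto simp: le_Suc_eq)
  next
    case (Suc n')
    have "p (Suc n) \<noteq> p n'" using inj_onD[OF Suc.prems(2), of "Suc n" n'] Suc by auto
    from IH show ?thesis
    proof
      assume up: "\<forall>r\<le>n. p r = p 0 + r"
      then have "p n = p 0 + n" "p n' = p 0 + n'" by (blast, metis Suc le_SucI order_refl)
      with st \<open>p (Suc n) \<noteq> p n'\<close> Suc have "p (Suc n) = p 0 + Suc n" by linarith
      with up show ?thesis by (metis le_Suc_eq)
    next
      assume down: "\<forall>r\<le>n. p 0 = p r + r"
      then have "p 0 = p n + n" "p 0 = p n' + n'" by (blast, metis Suc le_SucI order_refl)
      with st \<open>p (Suc n) \<noteq> p n'\<close> Suc have "p 0 = p (Suc n) + Suc n" by linarith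
      with down show ?thesis by (metis le_Suc_eq)
    qed
  qed
qed

primrec component :: "tree_vertex \<Rightarrow> nat" where
  "component (Root i) = i"
| "component (Arm i k r) = i"
| "component (Leaf i k l) = i"

text \<open>
An isomorphism \<open>f\<close> onto an induced subgraph sends hubs to stars. The branched restriction that
nestedness provides is taken for the set \<open>S\<close> of letters whose stars are in the image. One of the
\<open>b + 1\<close> trees contains no star of a base letter, and there the root has too many arms: each arm
leads first to a star whose letter is the branch predecessor or the branch successor of the letter of the
root.
\<close>

lemma nested_excludes_forest:
  assumes nested: "b_nested b \<alpha> A B H"
  shows "\<not> isomorphic (forest (Suc b) L) (induced (path_star_graph \<alpha>) W)"
proof
  assume iso: "isomorphic (forest (Suc b) L) (induced (path_star_graph \<alpha>) W)"
  let ?V = "forest_verts (Suc b) L"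
  from iso obtain f where f: "bij_betw f ?V W"
    and "\<forall>u\<in>?V. \<forall>v\<in>?V. {u, v} \<in> edges (forest (Suc b) L) \<longleftrightarrow>
            {f u, f v} \<in> edges (induced (path_star_graph \<alpha>) W)"
    unfolding isomorphic_def by auto
  then have adj: "ps_adj \<alpha> (f u) (f v) \<longleftrightarrow> link L u v \<or> link L v u" if "u \<in> ?V" "v \<in> ?V" for u v
    using that bij_betwE[OF f] by (auto simp: forest_edge_iff path_star_edge_iff)
  have injf: "inj_on f ?V" and fW: "f ` ?V = W" using f by (auto simp: bij_betw_def)
  have f_eq: "f u = f v \<longleftrightarrow> u = v" if "u \<in> ?V" "v \<in> ?V" for u v
    using injf that by (auto dest: inj_onD)
  \<comment> \<open>A path-vertex \<open>p\<^sub>j\<close> has at most three neighbours: two on the path and one star.\<close>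
  have hub: "\<exists>a. f v = Star a"
    if v: "v \<in> ?V" and X: "X \<subseteq> ?V" "card X = 4"
      and nb: "\<And>x. x \<in> X \<Longrightarrow> link L v x \<or> link L x v" for v X
  proof (cases "f v")
    case (Path j)
    have "f x \<in> {Path (j - 1), Path (Suc j), Star (\<alpha> j)}" if "x \<in> X" for x
    proof -
      have "ps_adj \<alpha> (Path j) (f x)" using adj[of v x] v X(1) nb[OF that] that Path by auto
      then show ?thesis by (cases "f x") auto
    qed
    then have "f ` X \<subseteq> {Path (j - 1), Path (Suc j), Star (\<alpha> j)}" by blast
    then have "card (f ` X) \<le> card {Path (j - 1), Path (Suc j), Star (\<alpha> j)}"
      by (intro card_mono) auto
    also have "\<dots> \<le> 3" by (simp add: card_insert_if)
    finally show ?thesis using X card_image[OF inj_on_subset[OF injf X(1)]] by simp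
  qed simp
  \<comment> \<open>Stars of letters outside the alphabet exist in the path-star graph but are isolated there;
    nestedness speaks only of subsets of the alphabet.\<close>
  define S where "S = {a \<in> A. Star a \<in> W}"
  from nested have over: "range \<alpha> \<subseteq> A" and recur: "\<And>a. a \<in> A \<Longrightarrow> infinite {j. \<alpha> j = a}"
    by (auto simp: b_nested_def branched_def word_over_def)
  from nested obtain B' H' where B': "card B' \<le> b"
    and br: "branched (restrict_word (Inf_Word \<alpha>) S) S B' H'"
    unfolding b_nested_def S_def by (metis (no_types, lifting) mem_Collect_eq subsetI)
  from br have finB: "finite B'" and disj: "disjoint_family H'"
    by (auto simp: branched_def branch_partition_def)
  \<comment> \<open>At most \<open>b\<close> base letters spoil at most \<open>b\<close> of the \<open>b + 1\<close> trees.\<close>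
  obtain i where i: "i < Suc b" and free: "\<And>v a. v \<in> ?V \<Longrightarrow> component v = i \<Longrightarrow> f v = Star a \<Longrightarrow> a \<notin> B'"
  proof -
    let ?T = "{v \<in> ?V. f v \<in> Star ` B'}"
    have injT: "inj_on f ?T" using injf by (auto intro: inj_on_subset)
    have "card ?T \<le> card (Star ` B')"
      using finB by (intro card_inj_on_le[OF injT]) auto
    also have "\<dots> \<le> b" using card_image_le[OF finB, of Star] B' by linarith
    finally have "card ?T \<le> b" .
    moreover have finT: "finite ?T" using finite_graph_forest[of "Suc b" L] by (auto simp: finite_graph_def)
    ultimately have "card (component ` ?T) < card {..<Suc b}"
      using card_image_le[of ?T component] by simp
    then have "\<not> {..<Suc b} \<subseteq> component ` ?T"
      using card_mono[of "component ` ?T" "{..<Suc b}"] finT by auto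
    then show thesis using that by blast
  qed
  have "\<exists>h. f (Root i) = Star h"
    by (rule hub[where X = "(\<lambda>k. Arm i k 0) ` {..<4}"]) (use i in \<open>auto simp: card_image inj_on_def\<close>)
  then obtain h where h: "f (Root i) = Star h" ..
  have arm: "\<exists>r a. r \<le> L \<and> f (Arm i k r) = Star a \<and> (branch_pred H' h a \<or> branch_pred H' a h)"
    if k: "k < 4" for k
  proof -
    define Q where "Q r \<longleftrightarrow> (\<exists>a. f (Arm i k r) = Star a)" for r
    have "Q L"
      unfolding Q_def
    proof (rule hub)
      let ?p = "if L = 0 then Root i else Arm i k (L - 1)"
      show "insert ?p (Leaf i k ` {..<3}) \<subseteq> ?V" using i k by auto
      show "card (insert ?p (Leaf i k ` {..<3})) = 4"
        by (subst card_insert_disjoint) (auto simp: card_image inj_on_def)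
      show "link L (Arm i k L) x \<or> link L x (Arm i k L)" if "x \<in> insert ?p (Leaf i k ` {..<3})" for x
        using that by (cases L) auto
    qed (use i k in simp)
    \<comment> \<open>The first star on the arm is at position \<open>n\<close>; between the root and it there are only
      path-vertices, at the positions \<open>p 0\<close> to \<open>p m\<close> of the word.\<close>
    define n where "n = (LEAST r. Q r)"
    have n: "Q n" "n \<le> L" and least: "\<And>r. r < n \<Longrightarrow> \<not> Q r"
      unfolding n_def using \<open>Q L\<close> by (auto intro: LeastI Least_le dest: not_less_Least)
    from n obtain a where a: "f (Arm i k n) = Star a" by (auto simp: Q_def)
    have n0: "n \<noteq> 0"
    proof
      assume "n = 0"
      then have "ps_adj \<alpha> (f (Root i)) (f (Arm i k n))" using i k by (subst adj) auto
      then show False by (simp add: h a)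
    qed
    then obtain m where m: "n = Suc m" by (cases n) auto
    have "\<exists>p. f (Arm i k r) = Path p" if "r \<le> m" for r
      using least[of r] that m by (cases "f (Arm i k r)") (auto simp: Q_def)
    then obtain p where p: "\<And>r. r \<le> m \<Longrightarrow> f (Arm i k r) = Path (p r)" by metis
    have start: "\<alpha> (p 0) = h"
    proof -
      have "ps_adj \<alpha> (f (Root i)) (f (Arm i k 0))" using i k by (subst adj) auto
      then show ?thesis by (simp add: h p)
    qed
    have stop: "\<alpha> (p m) = a"
    proof -
      have "ps_adj \<alpha> (f (Arm i k m)) (f (Arm i k n))" using i k m n by (subst adj) auto
      then show ?thesis by (simp add: a p)
    qed
    have "h \<noteq> a"
    proof
      assume "h = a"
      then have "f (Root i) = f (Arm i k n)" by (simp add: h a)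
      then show False using f_eq[of "Root i" "Arm i k n"] i k n by simp
    qed
    \<comment> \<open>Otherwise the star of that letter would be a third neighbour of a vertex of degree 2, whose
      two neighbours on the arm are path-vertices.\<close>
    have inner: "\<alpha> (p r) \<notin> S" if r: "0 < r" "r < m" for r
    proof
      assume "\<alpha> (p r) \<in> S"
      then obtain v where v: "v \<in> ?V" "f v = Star (\<alpha> (p r))" using fW by (auto simp: S_def)
      have "ps_adj \<alpha> (f (Arm i k r)) (f v)" using r by (simp add: v p)
      then have "link L (Arm i k r) v \<or> link L v (Arm i k r)"
        using adj[of "Arm i k r" v] v i k r m n by simp
      then have "v = Arm i k (r - 1) \<or> v = Arm i k (Suc r)"
        using r m n by (cases v) auto
      with r v(2) p[of "r - 1"] p[of "Suc r"] show False by auto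
    qed
    have mono: "(\<forall>r\<le>m. p r = p 0 + r) \<or> (\<forall>r\<le>m. p 0 = p r + r)"
    proof (rule unit_walk_monotone)
      fix r assume r: "r < m"
      then have "ps_adj \<alpha> (f (Arm i k r)) (f (Arm i k (Suc r)))"
        using i k m n by (subst adj) auto
      then show "p (Suc r) = Suc (p r) \<or> p r = Suc (p (Suc r))" using r by (simp add: p)
    next
      show "inj_on p {..m}"
      proof (rule inj_onI)
        fix r s assume rs: "r \<in> {..m}" "s \<in> {..m}" "p r = p s"
        then have "f (Arm i k r) = f (Arm i k s)" by (simp add: p)
        then show "r = s" using f_eq[of "Arm i k r" "Arm i k s"] i k rs m n by simp
      qed
    qed
    have "f (Root i) \<in> W" "f (Arm i k n) \<in> W" using i k n unfolding fW[symmetric] by simp_all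
    moreover have "h \<in> A" "a \<in> A" using start stop over by blast+
    ultimately have hS: "h \<in> S" and aS: "a \<in> S" by (simp_all add: S_def h a)
    have hB: "h \<notin> B'" using free[OF _ _ h] i by simp
    have aB: "a \<notin> B'" using free[OF _ _ a] i k n by simp
    have "infinite {j. \<alpha> j = h}" using hS recur by (simp add: S_def)
    then have inf: "infinite {j. \<alpha> j \<in> S}" by (rule infinite_super[rotated]) (use hS in auto)
    have m0: "m \<noteq> 0" using start stop \<open>h \<noteq> a\<close> by (cases m) auto
    from mono show ?thesis
    proof
      assume up: "\<forall>r\<le>m. p r = p 0 + r"
      then have um: "p m = p 0 + m" by blast
      have "branch_pred H' (\<alpha> (p 0)) (\<alpha> (p m))"
      proof (rule branch_pred_if_consecutive[OF br inf])
        fix w assume w: "p 0 < w" "w < p m"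
        with um have lt: "0 < w - p 0" "w - p 0 < m" by linarith+
        with up have "p (w - p 0) = p 0 + (w - p 0)" using less_imp_le by blast
        with w have "w = p (w - p 0)" by linarith
        then show "\<alpha> w \<notin> S" using inner lt by metis
      qed (use um m0 start stop hS aS hB aB in auto)
      with n(2) a start stop show ?thesis by blast
    next
      assume down: "\<forall>r\<le>m. p 0 = p r + r"
      have "branch_pred H' (\<alpha> (p m)) (\<alpha> (p 0))"
      proof (rule branch_pred_if_consecutive[OF br inf])
        fix w assume w: "p m < w" "w < p 0"
        have dm: "p 0 = p m + m" using down by blast
        with w have lt: "0 < p 0 - w" "p 0 - w < m" by linarith+
        with down have "p 0 = p (p 0 - w) + (p 0 - w)" using less_imp_le by blast
        with w have "w = p (p 0 - w)" by linarith
        then show "\<alpha> w \<notin> S" using inner lt by metis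
      next
        have "p 0 = p m + m" using down by blast
        then show "p m < p 0" using m0 by simp
      qed (use start stop hS aS hB aB in auto)
      with n(2) a start stop show ?thesis by blast
    qed
  qed
  obtain r a where r: "\<And>k. k < 4 \<Longrightarrow> r k \<le> L"
    and a: "\<And>k. k < 4 \<Longrightarrow> f (Arm i k (r k)) = Star (a k)"
    and pred: "\<And>k. k < 4 \<Longrightarrow> branch_pred H' h (a k) \<or> branch_pred H' (a k) h"
    using arm by metis
  have diff: "\<not> (branch_pred H' h (a k) \<and> branch_pred H' h (a l))"
      "\<not> (branch_pred H' (a k) h \<and> branch_pred H' (a l) h)" if "k < 4" "l < 4" "k \<noteq> l" for k l
  proof -
    have "a k \<noteq> a l"
    proof
      assume "a k = a l"
      then have "f (Arm i k (r k)) = f (Arm i l (r l))" using that by (simp add: a)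
      then show False using f_eq[of "Arm i k (r k)" "Arm i l (r l)"] i that r by simp
    qed
    with branch_pred_unique[OF disj] show
      "\<not> (branch_pred H' h (a k) \<and> branch_pred H' h (a l))"
      "\<not> (branch_pred H' (a k) h \<and> branch_pred H' (a l) h)" by blast+
  qed
  \<comment> \<open>Among three arms, two lead in the same direction along the branch set.\<close>
  show False
    using pred[of 0] pred[of 1] pred[of 2] diff[of 0 1] diff[of 0 2] diff[of 1 2] by simp blast
qed

section \<open>Finding spiders in a path-star graph\<close>

definition isolated_occurrences :: "(nat \<Rightarrow> 'a) \<Rightarrow> nat \<Rightarrow> 'a \<Rightarrow> nat set" where
  "isolated_occurrences \<alpha> L a = {j. \<alpha> j = a \<and> (\<forall>r\<in>{1..L}. \<alpha> (j + r) \<noteq> a)}"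

text \<open>
If only finitely many occurrences of \<open>a\<close> are isolated, then \<open>a\<close> appears in every late window of
\<open>L + 1\<close> positions. Such a window has room for only \<open>L + 1\<close> letters.
\<close>

lemma finite_letters_without_gaps:
  fixes \<alpha> :: "nat \<Rightarrow> 'a" and L :: nat
  assumes recur: "\<And>a. a \<in> A \<Longrightarrow> infinite {j. \<alpha> j = a}"
  shows "finite {a \<in> A. finite (isolated_occurrences \<alpha> L a)}"
proof (rule ccontr)
  assume "infinite {a \<in> A. finite (isolated_occurrences \<alpha> L a)}"
  from infinite_arbitrarily_large[OF this, of "L + 2"]
  obtain X where X: "finite X" "card X = L + 2"
      "X \<subseteq> {a \<in> A. finite (isolated_occurrences \<alpha> L a)}"
    by blast
  have "\<exists>n0. \<forall>n\<ge>n0. \<exists>r\<le>L. \<alpha> (n + r) = a" if "a \<in> X" for a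
  proof -
    from that X(3) have aA: "a \<in> A"
      and "finite (isolated_occurrences \<alpha> L a)" by auto
    then obtain N where N': "\<forall>j \<in> isolated_occurrences \<alpha> L a. j < N"
      unfolding finite_nat_set_iff_bounded by blast
    have N: "\<exists>r\<in>{1..L}. \<alpha> (j + r) = a" if "\<alpha> j = a" "N \<le> j" for j
    proof -
      have "j \<notin> isolated_occurrences \<alpha> L a" using N' that(2) by (meson leD)
      with that(1) show ?thesis by (simp add: isolated_occurrences_def)
    qed
    from recur[OF aA] obtain j0 where j0: "N \<le> j0" "\<alpha> j0 = a"
      by (auto simp: infinite_nat_iff_unbounded_le)
    have "\<exists>r\<le>L. \<alpha> (n + r) = a" if "j0 \<le> n" for n
      using that
    proof (induction n rule: dec_induct)
      case base
      with j0 show ?case by auto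
    next
      case (step n)
      from step.IH obtain r where r: "r \<le> L" "\<alpha> (n + r) = a" by blast
      show ?case
      proof (cases r)
        case 0
        with r N[of n] step.hyps j0 obtain r' where "r' \<in> {1..L}" "\<alpha> (n + r') = a" by auto
        then show ?thesis by (intro exI[of _ "r' - 1"]) auto
      next
        case (Suc r')
        with r show ?thesis by (intro exI[of _ r']) auto
      qed
    qed
    then show ?thesis by blast
  qed
  then obtain n0 where n0: "\<And>a n. a \<in> X \<Longrightarrow> n0 a \<le> n \<Longrightarrow> \<exists>r\<le>L. \<alpha> (n + r) = a" by metis
  define n where "n = Max (n0 ` X)"
  have "X \<subseteq> (\<lambda>r. \<alpha> (n + r)) ` {..L}"
  proof
    fix a assume a: "a \<in> X"
    then have "n0 a \<le> n" unfolding n_def using X(1) by simp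
    with n0[OF a] show "a \<in> (\<lambda>r. \<alpha> (n + r)) ` {..L}" by fastforce
  qed
  then have "card X \<le> card {..L}" by (rule surj_card_le[rotated]) simp
  with X(2) show False by simp
qed

text \<open>
A digraph with out-degrees at most \<open>L\<close> has average in-degree at most \<open>L\<close>, so it has a vertex with at
most \<open>2 * L\<close> neighbours in total. Choosing this vertex, deleting it with its neighbours, and repeating
gives an independent set.
\<close>

lemma ex_independent_subset:
  fixes F :: "'a \<Rightarrow> 'a set"
  assumes "finite Y" "\<And>a. a \<in> Y \<Longrightarrow> finite (F a) \<and> card (F a) \<le> L" "(2 * L + 1) * q \<le> card Y"
  shows "\<exists>Z \<subseteq> Y. card Z = q \<and> (\<forall>a\<in>Z. \<forall>b\<in>Z. a \<noteq> b \<longrightarrow> b \<notin> F a)"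
  using assms
proof (induction q arbitrary: Y)
  case 0
  then show ?case by (intro exI[of _ "{}"]) auto
next
  case (Suc q)
  note fin = Suc.prems(1)
  have "\<exists>y\<in>Y. card {a \<in> Y. y \<in> F a} \<le> L"
  proof (rule ccontr)
    assume "\<not> ?thesis"
    then have "(\<Sum>y\<in>Y. Suc L) \<le> (\<Sum>y\<in>Y. card {a \<in> Y. y \<in> F a})"
      by (intro sum_mono) (auto simp: not_le)
    also have "\<dots> = (\<Sum>a\<in>Y. card {y \<in> Y. y \<in> F a})"
      using sum.swap_restrict[OF fin fin, of "\<lambda>_ _. 1::nat" "\<lambda>y a. y \<in> F a"] by simp
    also have "\<dots> \<le> (\<Sum>a\<in>Y. L)"
    proof (rule sum_mono)
      fix a assume "a \<in> Y"
      with Suc.prems(2) have "finite (F a)" "card (F a) \<le> L" by auto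
      moreover from this have "card {y \<in> Y. y \<in> F a} \<le> card (F a)" by (intro card_mono) auto
      ultimately show "card {y \<in> Y. y \<in> F a} \<le> L" by linarith
    qed
    finally have "card Y = 0" by simp
    with Suc.prems(3) show False by simp
  qed
  then obtain y where y: "y \<in> Y" "card {a \<in> Y. y \<in> F a} \<le> L" by blast
  define D where "D = insert y (F y \<union> {a \<in> Y. y \<in> F a})"
  have Fy: "finite (F y)" "card (F y) \<le> L" using Suc.prems(2)[OF y(1)] by auto
  have "finite D" unfolding D_def using Fy fin by simp
  have "card D \<le> Suc (card (F y \<union> {a \<in> Y. y \<in> F a}))"
    unfolding D_def by (rule card_insert_le_m1) simp_all
  also have "\<dots> \<le> Suc (card (F y) + card {a \<in> Y. y \<in> F a})"
    by (simp add: card_Un_le)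
  finally have "card D \<le> 2 * L + 1" using Fy y(2) by linarith
  moreover have "card Y - card D \<le> card (Y - D)"
    by (rule diff_card_le_card_Diff[OF \<open>finite D\<close>])
  ultimately have "(2 * L + 1) * q \<le> card (Y - D)" using Suc.prems(3) by simp
  with Suc.IH[of "Y - D"] Suc.prems(1,2) obtain Z where
    Z: "Z \<subseteq> Y - D" "card Z = q" "\<forall>a\<in>Z. \<forall>b\<in>Z. a \<noteq> b \<longrightarrow> b \<notin> F a" by auto
  have "finite Z" using Z(1) fin by (auto intro: finite_subset)
  show ?case
  proof (intro exI conjI)
    show "insert y Z \<subseteq> Y" using Z(1) y(1) by auto
    show "card (insert y Z) = Suc q" using Z(1,2) \<open>finite Z\<close> by (subst card_insert_disjoint) (auto simp: D_def)
    show "\<forall>a\<in>insert y Z. \<forall>b\<in>insert y Z. a \<noteq> b \<longrightarrow> b \<notin> F a"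
      using Z(1,3) by (auto simp: D_def)
  qed
qed

lemma ex_spaced_choice:
  fixes D :: "nat \<Rightarrow> nat set"
  assumes "\<And>n. infinite (D n)"
  shows "\<exists>f. (\<forall>n. f n \<in> D n) \<and> (\<forall>m n. m < n \<longrightarrow> f m + K < f n)"
proof -
  have "\<exists>f. \<forall>n. f n \<in> D n \<and> f n + K < f (Suc n)"
  proof (rule dependent_nat_choice)
    show "\<exists>x. x \<in> D 0" using infinite_imp_nonempty[OF assms] by blast
    show "\<exists>y. y \<in> D (Suc n) \<and> x + K < y" for x n
      using assms[of "Suc n"] by (auto simp: infinite_nat_iff_unbounded)
  qed
  then obtain f where f: "\<And>n. f n \<in> D n" "\<And>n. f n + K < f (Suc n)" by blast
  have "f m + K < f n" if "m < n" for m n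
    using that
  proof (induction n rule: less_Suc_induct)
    case (1 i) show ?case by (rule f(2))
  next
    case (2 i j k) then show ?case by linarith
  qed
  with f(1) show ?thesis by blast
qed

text \<open>
The spider with index \<open>c\<close> has the star of the letter \<open>hub c\<close> in its middle, and its leg number \<open>k\<close>
consists of the path-vertices at the positions \<open>leg c k r\<close>, where \<open>r \<le> L\<close> is counted from the hub. The
three equivalences say exactly which of these path-vertices coincide, follow one another on the path, or
are attached to a hub; so spiders with different indices are disjoint and not joined by edges.
\<close>

definition spiders ::
  "(nat \<Rightarrow> nat) \<Rightarrow> nat \<Rightarrow> 'c set \<Rightarrow> ('c \<Rightarrow> nat) \<Rightarrow> ('c \<Rightarrow> nat \<Rightarrow> nat \<Rightarrow> nat) \<Rightarrow> bool" where
  "spiders \<alpha> L I hub leg \<longleftrightarrow> inj_on hub I \<and>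
     (\<forall>c\<in>I. \<forall>c'\<in>I. \<forall>k k' r r'. r \<le> L \<longrightarrow> r' \<le> L \<longrightarrow>
       (leg c k r = leg c' k' r' \<longleftrightarrow> c = c' \<and> k = k' \<and> r = r') \<and>
       (leg c k r = Suc (leg c' k' r') \<longleftrightarrow> c = c' \<and> k = k' \<and> r = Suc r') \<and>
       (\<alpha> (leg c k r) = hub c' \<longleftrightarrow> c = c' \<and> r = 0))"

lemma spidersD:
  assumes "spiders \<alpha> L I hub leg" "c \<in> I" "c' \<in> I" "r \<le> L"
  shows "hub c = hub c' \<longleftrightarrow> c = c'"
    and "r' \<le> L \<Longrightarrow> leg c k r = leg c' k' r' \<longleftrightarrow> c = c' \<and> k = k' \<and> r = r'"
    and "r' \<le> L \<Longrightarrow> leg c k r = Suc (leg c' k' r') \<longleftrightarrow> c = c' \<and> k = k' \<and> r = Suc r'"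
    and "\<alpha> (leg c k r) = hub c' \<longleftrightarrow> c = c' \<and> r = 0"
  using assms unfolding spiders_def by (blast dest: inj_onD)+

text \<open>
All but finitely many letters have infinitely many isolated occurrences. Let \<open>Y\<close> be a large finite set of
such letters. For each \<open>a\<close> in \<open>Y\<close>, by the pigeonhole principle, infinitely many isolated occurrences of \<open>a\<close>
are followed by windows that contain the same letters of \<open>Y\<close>, at most \<open>L\<close> of them. Draw an arc from \<open>a\<close>
to each of these letters. The letters of an independent set serve as hubs, and occurrences
of them that are far apart from each other serve as the beginnings of the legs.
\<close>

lemma ex_spiders:
  fixes \<alpha> :: "nat \<Rightarrow> nat" and I :: "'c::countable set" and L :: nat
  assumes infA: "infinite A" and recur: "\<And>a. a \<in> A \<Longrightarrow> infinite {j. \<alpha> j = a}" and finI: "finite I"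
  shows "\<exists>hub leg. hub ` I \<subseteq> A \<and> spiders \<alpha> L I hub leg"
proof -
  let ?occ = "isolated_occurrences \<alpha> L"
  have "A - {a \<in> A. finite (?occ a)} = {a \<in> A. infinite (?occ a)}" by blast
  then have "infinite {a \<in> A. infinite (?occ a)}"
    using Diff_infinite_finite[OF finite_letters_without_gaps[OF recur] infA] by metis
  from infinite_arbitrarily_large[OF this, of "(2 * L + 1) * card I"]
  obtain Y where Y: "finite Y" "card Y = (2 * L + 1) * card I"
      "Y \<subseteq> {a \<in> A. infinite (?occ a)}"
    by blast
  define win where "win j = (\<lambda>r. \<alpha> (j + r)) ` {1..L} \<inter> Y" for j
  have "\<exists>j0 \<in> ?occ a. infinite {j \<in> ?occ a. win j = win j0}" if "a \<in> Y" for a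
  proof (rule pigeonhole_infinite)
    show "infinite (?occ a)" using that Y(3) by blast
    have "win ` ?occ a \<subseteq> Pow Y" by (auto simp: win_def)
    then show "finite (win ` ?occ a)" by (rule finite_subset) (simp add: Y(1))
  qed
  then have "\<forall>a\<in>Y. \<exists>j0. infinite {j \<in> ?occ a. win j = win j0}" by blast
  from bchoice[OF this]
  obtain j0 where j0: "\<And>a. a \<in> Y \<Longrightarrow> infinite {j \<in> ?occ a. win j = win (j0 a)}" by blast
  have "finite (win (j0 a)) \<and> card (win (j0 a)) \<le> L" for a
  proof
    have "card (win (j0 a)) \<le> card ((\<lambda>r. \<alpha> (j0 a + r)) ` {1..L})" 
      by (intro card_mono) (auto simp: win_def)
    also have "\<dots> \<le> L" using card_image_le[of "{1..L}" "\<lambda>r. \<alpha> (j0 a + r)"] by simp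
    finally show "card (win (j0 a)) \<le> L" .
  qed (simp add: win_def)
  with ex_independent_subset[OF Y(1), of "\<lambda>a. win (j0 a)" L "card I"] Y(2)
  obtain Z where Z: "Z \<subseteq> Y" "card Z = card I"
      "\<And>a b. a \<in> Z \<Longrightarrow> b \<in> Z \<Longrightarrow> a \<noteq> b \<Longrightarrow> b \<notin> win (j0 a)" by auto
  have "finite Z" using Z(1) Y(1) by (rule finite_subset)
  then obtain hub where hub: "bij_betw hub I Z" using finI Z(2) finite_same_card_bij by metis
  have hubZ: "hub c \<in> Z" if "c \<in> I" for c using hub that by (auto dest: bij_betwE)
  have injhub: "inj_on hub I" using hub by (simp add: bij_betw_def)
  \<comment> \<open>Pairs of a spider and a leg are numbered, and the beginnings of the legs are chosen one after
    the other; the value \<open>UNIV\<close> fills the numbers that belong to no spider.\<close>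
  define D where "D n = (case from_nat n of (c :: 'c, k :: nat) \<Rightarrow>
      if c \<in> I then {j \<in> ?occ (hub c). win j = win (j0 (hub c))} else UNIV)" for n
  have "infinite (D n)" for n
    using j0 hubZ Z(1) by (auto simp: D_def split: prod.split)
  then obtain f where fD: "\<And>n. f n \<in> D n" and sp: "\<And>m n. m < n \<Longrightarrow> f m + Suc L < f n"
    using ex_spaced_choice[of D "Suc L"] by metis
  define leg where "leg c k r = f (to_nat (c, k)) + r" for c :: 'c and k r :: nat
  have start: "\<alpha> (leg c k 0) = hub c" and avoid: "\<And>r a. r \<in> {1..L} \<Longrightarrow> a \<in> Z \<Longrightarrow> \<alpha> (leg c k r) \<noteq> a"
    if c: "c \<in> I" for c k
  proof -
    let ?j = "f (to_nat (c, k))"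
    have "?j \<in> ?occ (hub c)" "win ?j = win (j0 (hub c))"
      using fD[of "to_nat (c, k)"] c by (auto simp: D_def)
    then have j: "\<alpha> ?j = hub c" "\<And>r. r \<in> {1..L} \<Longrightarrow> \<alpha> (?j + r) \<noteq> hub c"
      and w: "win ?j = win (j0 (hub c))" by (simp_all add: isolated_occurrences_def)
    from j show "\<alpha> (leg c k 0) = hub c" by (simp add: leg_def)
    fix r a assume ra: "r \<in> {1..L}" "a \<in> Z"
    show "\<alpha> (leg c k r) \<noteq> a"
    proof
      assume eq: "\<alpha> (leg c k r) = a"
      with j(2)[OF ra(1)] have "hub c \<noteq> a" by (simp add: leg_def)
      from Z(3)[OF hubZ[OF c] ra(2) this] have "a \<notin> win ?j" unfolding w .
      moreover have "a \<in> Y" using ra(2) Z(1) by blast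
      ultimately show False using eq ra(1) by (auto simp: leg_def win_def)
    qed
  qed
  have far: "leg c k r \<noteq> leg c' k' r' \<and> leg c k r \<noteq> Suc (leg c' k' r')"
    if "r \<le> L" "r' \<le> L" "(c, k) \<noteq> (c', k')" for c c' k k' r r'
  proof -
    from that(3) have "to_nat (c, k) \<noteq> to_nat (c', k')" by simp
    then have "f (to_nat (c, k)) + Suc L < f (to_nat (c', k')) \<or>
        f (to_nat (c', k')) + Suc L < f (to_nat (c, k))"
      using sp by (metis linorder_neqE_nat)
    with that(1,2) show ?thesis unfolding leg_def by linarith
  qed
  have "spiders \<alpha> L I hub leg"
    unfolding spiders_def
  proof (intro conjI ballI allI impI injhub)
    fix c c' k k' r r' assume cc: "c \<in> I" "c' \<in> I" and r: "r \<le> L" and r': "r' \<le> L"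
    show "\<alpha> (leg c k r) = hub c' \<longleftrightarrow> c = c' \<and> r = 0"
    proof (cases "r = 0")
      case True
      then show ?thesis using start[OF cc(1)] cc injhub by (auto dest: inj_onD)
    next
      case False
      then show ?thesis using avoid[OF cc(1), of r "hub c'"] hubZ[OF cc(2)] r by auto
    qed
    show "leg c k r = leg c' k' r' \<longleftrightarrow> c = c' \<and> k = k' \<and> r = r'"
      using far[OF r r', of c k c' k'] by (cases "(c, k) = (c', k')") (auto simp: leg_def)
    show "leg c k r = Suc (leg c' k' r') \<longleftrightarrow> c = c' \<and> k = k' \<and> r = Suc r'"
      using far[OF r r', of c k c' k'] by (cases "(c, k) = (c', k')") (auto simp: leg_def)
  qed
  moreover have "hub ` I \<subseteq> A" using hubZ Z(1) Y(3) by blast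
  ultimately show ?thesis by blast
qed

section \<open>Small parts of the forests\<close>

text \<open>
A set \<open>U\<close> with fewer than \<open>L\<close> vertices misses a vertex \<open>d i k\<close> on each arm. What remains of the arm splits
into a leg of the spider at the root and leg number 0 of the spider at the end of the arm, which
is traversed backwards; the three leaves there go to the legs 1, 2 and 3. The spider of the root of
tree \<open>i\<close> has index \<open>(i, 0)\<close>, and the one at the end of arm \<open>k\<close> has index \<open>(i, Suc k)\<close>.
\<close>

lemma small_part_of_forest_embeds:
  assumes infA: "infinite A" and A1: "A \<subseteq> {1..}"
    and recur: "\<And>a. a \<in> A \<Longrightarrow> infinite {j. \<alpha> j = a}"
    and U: "U \<subseteq> forest_verts m L" "card U < L"
  shows "\<exists>W \<subseteq> verts (path_star_graph \<alpha>).
           isomorphic (induced (forest m L) U) (induced (path_star_graph \<alpha>) W)"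
proof -
  have finU: "finite U"
    using finite_graph_forest[of m L] U(1) by (auto simp: finite_graph_def intro: finite_subset)
  have "\<exists>r<L. Arm i k r \<notin> U" for i k
  proof (rule ccontr)
    assume "\<not> ?thesis"
    then have "Arm i k ` {..<L} \<subseteq> U" by auto
    then have "card (Arm i k ` {..<L}) \<le> card U" by (rule card_mono[OF finU])
    with U(2) show False by (simp add: card_image inj_on_def)
  qed
  then obtain d where d: "\<And>i k. d i k < L" "\<And>i k. Arm i k (d i k) \<notin> U" by metis
  define I where "I = {..<m} \<times> {..4::nat}"
  have I: "(i, k) \<in> I \<longleftrightarrow> i < m \<and> k \<le> 4" for i k by (auto simp: I_def)
  have "finite I" by (simp add: I_def)
  obtain hub leg where hubA: "hub ` I \<subseteq> A" and sp: "spiders \<alpha> L I hub leg"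
    using ex_spiders[where L = L, OF infA recur \<open>finite I\<close>] by blast
  note leg = spidersD(2-4)[OF sp]
  have hub: "hub c = hub c' \<longleftrightarrow> c = c'" if "c \<in> I" "c' \<in> I" for c c'
    using spidersD(1)[OF sp that, of 0] by simp
  define g where "g v = (case v of
      Root i \<Rightarrow> Star (hub (i, 0))
    | Arm i k r \<Rightarrow>
        (if r < d i k then Path (leg (i, 0) k r)
         else if r = L then Star (hub (i, Suc k))
         else Path (leg (i, Suc k) 0 (L - 1 - r)))
    | Leaf i k l \<Rightarrow> Path (leg (i, Suc k) (Suc l) 0))" for v
  have arm: "i < m \<and> k < 4 \<and> r \<le> L \<and> r \<noteq> d i k \<and> d i k < L" if "Arm i k r \<in> U" for i k r
    using that U(1) d by auto
  have leaf: "i < m \<and> k < 4 \<and> l < 3" if "Leaf i k l \<in> U" for i k l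
    using that U(1) by auto
  have root: "i < m" if "Root i \<in> U" for i
    using that U(1) by auto
  have inj_g: "inj_on g U"
  proof (rule inj_onI)
    fix u v assume "u \<in> U" "v \<in> U" "g u = g v"
    then show "u = v"
      by (cases u; cases v)
        (auto simp: g_def leg hub I dest!: arm leaf root split: if_splits)
  qed
  have adj: "ps_adj \<alpha> (g u) (g v) \<longleftrightarrow> link L u v \<or> link L v u" if "u \<in> U" "v \<in> U" for u v
    using that
    by (cases u; cases v)
      (auto simp: g_def leg hub I dest!: arm leaf root split: if_splits)
  show ?thesis
  proof (intro exI conjI)
    have star: "Star (hub c) \<in> verts (path_star_graph \<alpha>)" if "c \<in> I" for c
      using hubA A1 that by (auto simp: path_star_graph_def)
    have path: "Path j \<in> verts (path_star_graph \<alpha>)" for j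
      by (simp add: path_star_graph_def)
    have "g u \<in> verts (path_star_graph \<alpha>)" if "u \<in> U" for u
      using that by (cases u) (auto simp: g_def I intro!: star path dest!: arm leaf root)
    then show "g ` U \<subseteq> verts (path_star_graph \<alpha>)" by blast
    show "isomorphic (induced (forest m L) U) (induced (path_star_graph \<alpha>) (g ` U))"
      unfolding isomorphic_def
    proof (intro exI conjI ballI)
      show "bij_betw g (verts (induced (forest m L) U)) (verts (induced (path_star_graph \<alpha>) (g ` U)))"
        using inj_g by (simp add: bij_betw_def)
      fix u v assume "u \<in> verts (induced (forest m L) U)" "v \<in> verts (induced (forest m L) U)"
      then show "{u, v} \<in> edges (induced (forest m L) U) \<longleftrightarrow>
          {g u, g v} \<in> edges (induced (path_star_graph \<alpha>) (g ` U))"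
        using adj[of u v] U(1) by (auto simp: forest_edge_iff path_star_edge_iff)
    qed
  qed
qed

text \<open>
For given \<open>N\<close>, the witness consists of \<open>b + 1\<close> trees whose arms have more than \<open>N\<close> vertices before the hub at
the end.
\<close>

theorem corollary5p12:
  fixes \<alpha> :: "nat \<Rightarrow> nat"
  assumes "nested \<alpha>"
  shows "infinitely_defined (path_star_class \<alpha>)"
proof (rule infinitely_definedI[OF hereditary_path_star_class])
  fix N
  from assms obtain b A B H where nest: "b_nested b \<alpha> A B H" by (auto simp: nested_def)
  then have infA: "infinite A" and A1: "A \<subseteq> {1..}"
    and recur: "\<And>a. a \<in> A \<Longrightarrow> infinite {j. \<alpha> j = a}"
    by (auto simp: b_nested_def branched_def word_over_def)
  let ?F = "forest (Suc b) (Suc N)"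
  obtain G :: "nat graph" where G: "finite_graph G" "isomorphic ?F G"
    using ex_nat_copy[OF finite_graph_forest] by blast
  have "G \<notin> path_star_class \<alpha>"
    unfolding path_star_class_iff
    using nested_excludes_forest[OF nest] isomorphic_trans[OF G(2)] by blast
  moreover have "induced G X \<in> path_star_class \<alpha>" if X: "X \<subseteq> verts G" "card X \<le> N" for X
  proof -
    obtain U where U: "U \<subseteq> verts ?F" "isomorphic (induced G X) (induced ?F U)"
      using isomorphic_induced[OF isomorphic_sym[OF G(2)] X(1)] by blast
    from isomorphic_card[OF U(2)] X(2) have "card U < Suc N" by simp
    with small_part_of_forest_embeds[OF infA A1 recur, of U "Suc b" "Suc N"] U(1)
    obtain W where "W \<subseteq> verts (path_star_graph \<alpha>)"
        "isomorphic (induced ?F U) (induced (path_star_graph \<alpha>) W)" by auto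
    with U(2) show ?thesis
      using finite_graph_induced[OF G(1) X(1)] by (meson path_star_class_iff isomorphic_trans)
  qed
  ultimately show "\<exists>G. finite_graph G \<and> G \<notin> path_star_class \<alpha> \<and>
      (\<forall>U\<subseteq>verts G. card U \<le> N \<longrightarrow> induced G U \<in> path_star_class \<alpha>)"
    using G(1) by blast
qed

end
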